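(* For $k\in\mathbb{N}$, $k\ge1$, let $Q_k=\{-1,1\}^k$ and $\mathcal{B}_k^k=\mathrm{Lin}\{w_S:S\subset\{1,\ldots,k\}\}\subset\mathbb{R}^{Q_k}$, where $w_S(x)=\prod_{i\in S}x_i$. Then $k2^k\log2$ is a sharp threshold of the sample size for the existence of the maximum likelihood estimator (MLE) for $e(\mathcal{B}_k^k)$ and i.i.d. samples uniform on $Q_k$. That is, for every $\varepsilon\in(0,1)$, if for each $k$ the random variables $X_1,X_2,\ldots$ are independent and uniformly distributed on $Q_k$, and $\nu=\nu(k)$ is the smallest $n\ge1$ such that the MLE for $e(\mathcal{B}_k^k)$ and $X_1,\ldots,X_n$ exists, then, as $k\to\infty$, $$\mathbb{P}\left(\nu<(1-\varepsilon)k2^k\log2\right)\to0\quad\text{and}\quad\mathbb{P}\left(\nu<(1+\varepsilon)k2^k\log2\right)\to1.$$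
   Context: $\log$ is the natural logarithm. The weight on $Q_k$ is $\mu(\chi)=2^{-k}$. For $\phi\in\mathbb{R}^{Q_k}$ let $e(\phi)=e^{\phi}/\sum_{x\in Q_k}e^{\phi(x)}\mu(x)$, and $e(\mathcal{B})=\{e(\phi):\phi\in\mathcal{B}\}$ for a linear subspace $\mathcal{B}$. An element $\hat p\in e(\mathcal{B})$ is the MLE for $e(\mathcal{B})$ and $x_1,\ldots,x_n\in Q_k$ if $\prod_{i=1}^n\hat p(x_i)=\sup_{p\in e(\mathcal{B})}\prod_{i=1}^np(x_i)$. The time $\nu$ equals $\inf\{n\ge1:\{X_1,\ldots,X_n\}\text{ is a set of uniqueness for }(\mathcal{B}_k^k)_+\}$, where $\mathcal{B}_+$ denotes the set of nonnegative functions in $\mathcal{B}$ and $U\subset Q_k$ is a set of uniqueness for $\mathcal{B}_+$ if the only $\phi\in\mathcal{B}_+$ vanishing on $U$ is $\phi=0$ (existence of the MLE for a sample is equivalent to the sample being a set of uniqueness). If no such $n$ exists, $\nu=\infty$. *)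

theory Defs
  imports "HOL-Probability.Probability"
begin

definition cube :: "nat \<Rightarrow> (nat \<Rightarrow> real) set" where
  "cube k = {1..k} \<rightarrow>\<^sub>E {-1, 1}"

definition cube_weight :: "nat \<Rightarrow> (nat \<Rightarrow> real) \<Rightarrow> real" where
  "cube_weight k x = 1 / 2 ^ k"

definition walsh :: "nat set \<Rightarrow> (nat \<Rightarrow> real) \<Rightarrow> real" where
  "walsh S x = (\<Prod>i\<in>S. x i)"

text \<open>
  Elements of \<open>\<real>\<close>-valued function space on \<open>cube k\<close> are represented by functions that are
  extensional on \<open>cube k\<close>, so that equality of functions means agreement on the cube.
\<close>

definition walsh_space :: "nat \<Rightarrow> ((nat \<Rightarrow> real) \<Rightarrow> real) set" where
  "walsh_space k =
     {\<phi>. \<exists>c. \<phi> = (\<lambda>x\<in>cube k. \<Sum>S\<in>Pow {1..k}. c S * walsh S x)}"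

definition exp_density ::
    "nat \<Rightarrow> ((nat \<Rightarrow> real) \<Rightarrow> real) \<Rightarrow> (nat \<Rightarrow> real) \<Rightarrow> real" where
  "exp_density k \<phi> =
     (\<lambda>x\<in>cube k. exp (\<phi> x) / (\<Sum>y\<in>cube k. exp (\<phi> y) * cube_weight k y))"

definition exp_family ::
    "nat \<Rightarrow> ((nat \<Rightarrow> real) \<Rightarrow> real) set \<Rightarrow> ((nat \<Rightarrow> real) \<Rightarrow> real) set" where
  "exp_family k B = exp_density k ` B"

definition likelihood ::
    "nat \<Rightarrow> (nat \<Rightarrow> nat \<Rightarrow> real) \<Rightarrow> ((nat \<Rightarrow> real) \<Rightarrow> real) \<Rightarrow> real" where
  "likelihood n x p = (\<Prod>i=1..n. p (x i))"

text \<open>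
  The supremum below is a supremum of reals. It is the genuine one for points \<open>x i\<close> of the
  cube and nonempty \<open>B\<close>: every density in the family takes values in \<open>{0<..2 ^ k}\<close> there,
  so the set of likelihoods is nonempty and bounded.
\<close>

definition is_MLE ::
    "nat \<Rightarrow> ((nat \<Rightarrow> real) \<Rightarrow> real) set \<Rightarrow> nat \<Rightarrow> (nat \<Rightarrow> nat \<Rightarrow> real) \<Rightarrow>
     ((nat \<Rightarrow> real) \<Rightarrow> real) \<Rightarrow> bool" where
  "is_MLE k B n x p \<longleftrightarrow>
     p \<in> exp_family k B \<and> likelihood n x p = (SUP q\<in>exp_family k B. likelihood n x q)"

text \<open>In \<^typ>\<open>enat\<close> the infimum of the empty set is \<open>\<infinity>\<close>.\<close>

definition MLE_time ::
    "nat \<Rightarrow> ((nat \<Rightarrow> real) \<Rightarrow> real) set \<Rightarrow> (nat \<Rightarrow> nat \<Rightarrow> real) \<Rightarrow> enat" where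
  "MLE_time k B x = (INF n\<in>{n. n \<ge> 1 \<and> (\<exists>p. is_MLE k B n x p)}. enat n)"

end

theory Submission
  imports Defs "HOL-Real_Asymp.Real_Asymp"
begin

text \<open>
  All subsets of \<open>{1..k}\<close> are admitted as indices, so the Walsh functions span the space of all
  functions on the cube, and the exponential family consists of all strictly positive densities
  (\<open>walsh_space_eq_extensional\<close>, \<open>exp_family_walsh_space\<close>). In this saturated model the MLE, if it
  exists, is the empirical density. It is strictly positive exactly when every point of the cube
  has been sampled. If some point is missing, mass can be moved from it to the sampled points
  and the likelihood grows, so no maximum is attained. Hence \<open>\<nu>\<close> is the time at which a coupon
  collector with \<open>N = 2 ^ k\<close> equally likely coupons completes the collection
  (\<open>MLE_time_less_iff\<close>), and \<open>k 2\<^sup>k ln 2 = N ln N\<close>.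

  After \<open>n\<close> draws the expected number of missing coupons is \<open>N (1 - 1/N)\<^sup>n\<close>, about
  \<open>exp (ln N - n / N)\<close>. For \<open>n\<close> above \<open>(1 + \<epsilon>) N ln N\<close> this tends to \<open>0\<close>, and the union bound
  shows that the collection is complete (\<open>prob_covered_ge_exp\<close>). For \<open>n\<close> below
  \<open>(1 - \<epsilon>) N ln N\<close> it tends to infinity. The events that two different coupons are missing are
  not positively correlated, because \<open>1 - 2/N \<le> (1 - 1/N)\<^sup>2\<close>, so the variance of the number of missing
  coupons is at most its mean. Chebyshev's inequality then makes a complete collection unlikely
  (\<open>prob_covered_le_exp\<close>).
\<close>

section \<open>The Walsh functions span all functions on the cube\<close>

lemma finite_cube [simp]: "finite (cube k)"
  unfolding cube_def by (intro finite_PiE) auto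

lemma card_cube [simp]: "card (cube k) = 2 ^ k"
  unfolding cube_def by (simp add: card_PiE card_insert_if flip: numeral_2_eq_2)

lemma cube_nonempty: "cube k \<noteq> {}"
  using card_cube[of k] by (metis card.empty power_not_zero zero_neq_numeral)

text \<open>
  The sum is the expansion of the product \<open>\<Prod>i. 1 + x\<^sub>i y\<^sub>i\<close>, each factor of which is \<open>2\<close> or \<open>0\<close>
  according to whether \<open>x\<close> and \<open>y\<close> agree in that coordinate.
\<close>

lemma walsh_kernel:
  assumes "x \<in> cube k" "y \<in> cube k"
  shows "(\<Sum>S\<in>Pow {1..k}. walsh S y * walsh S x) = (if x = y then 2 ^ k else 0)"
proof -
  have "(\<Sum>S\<in>Pow {1..k}. walsh S y * walsh S x) = (\<Prod>i\<in>{1..k}. y i * x i + 1)"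
    by (subst prod_add) (auto simp: walsh_def prod.distrib)
  also have "\<dots> = (if x = y then 2 ^ k else 0)"
  proof (cases "x = y")
    case True
    have "y i * x i + 1 = 2" if "i \<in> {1..k}" for i
    proof -
      have "x i \<in> {-1, 1}" using that assms(1) unfolding cube_def by blast
      then show ?thesis using True by auto
    qed
    then have "(\<Prod>i\<in>{1..k}. y i * x i + 1) = (\<Prod>i\<in>{1..k}. 2)"
      by (intro prod.cong) auto
    then show ?thesis using True by simp
  next
    case False
    then obtain i where i: "i \<in> {1..k}" "x i \<noteq> y i"
      using assms unfolding cube_def by (meson PiE_ext)
    have "x i \<in> {-1, 1}" "y i \<in> {-1, 1}" using i assms unfolding cube_def by blast+
    then have "y i * x i + 1 = 0" using i(2) by auto
    then have "(\<Prod>i\<in>{1..k}. y i * x i + 1) = 0" using i(1) by (intro prod_zero) auto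
    then show ?thesis using False by simp
  qed
  finally show ?thesis .
qed

lemma walsh_space_eq_extensional: "walsh_space k = extensional (cube k)"
proof
  show "walsh_space k \<subseteq> extensional (cube k)"
    unfolding walsh_space_def by auto
  show "extensional (cube k) \<subseteq> walsh_space k"
  proof
    fix \<phi> :: "(nat \<Rightarrow> real) \<Rightarrow> real" assume ext: "\<phi> \<in> extensional (cube k)"
    \<comment> \<open>The Fourier--Walsh coefficients of \<open>\<phi>\<close>; the kernel identity is the inversion formula.\<close>
    define c where "c S = (\<Sum>y\<in>cube k. \<phi> y * walsh S y) / 2 ^ k" for S
    have "(\<Sum>S\<in>Pow {1..k}. c S * walsh S x) = \<phi> x" if x: "x \<in> cube k" for x
    proof -
      have "(\<Sum>S\<in>Pow {1..k}. c S * walsh S x)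
          = (\<Sum>S\<in>Pow {1..k}. \<Sum>y\<in>cube k. \<phi> y / 2 ^ k * (walsh S y * walsh S x))"
        unfolding c_def sum_divide_distrib sum_distrib_right by (simp add: mult.assoc)
      also have "\<dots> = (\<Sum>y\<in>cube k. \<phi> y / 2 ^ k * (\<Sum>S\<in>Pow {1..k}. walsh S y * walsh S x))"
        by (subst sum.swap) (simp add: sum_distrib_left)
      also have "\<dots> = (\<Sum>y\<in>cube k. if x = y then \<phi> y else 0)"
        by (intro sum.cong refl) (simp add: walsh_kernel[OF x] del: One_nat_def)
      also have "\<dots> = \<phi> x" using x by simp
      finally show ?thesis .
    qed
    then have "\<phi> = (\<lambda>x\<in>cube k. \<Sum>S\<in>Pow {1..k}. c S * walsh S x)"
      using ext by (auto simp: extensional_def restrict_def)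
    then show "\<phi> \<in> walsh_space k" unfolding walsh_space_def by blast
  qed
qed

section \<open>Existence of the maximum likelihood estimator\<close>

text \<open>Since the space contains every function, a positive density is reached from its logarithm.\<close>

lemma exp_family_walsh_space:
  "exp_family k (walsh_space k) =
     {p \<in> extensional (cube k). (\<forall>x\<in>cube k. 0 < p x) \<and> (\<Sum>x\<in>cube k. p x) = 2 ^ k}"
  (is "?L = ?R")
proof
  show "?L \<subseteq> ?R"
  proof
    fix p assume "p \<in> ?L"
    then obtain \<phi> where p: "p = exp_density k \<phi>" unfolding exp_family_def by blast
    define Z where "Z = (\<Sum>y\<in>cube k. exp (\<phi> y))"
    have Z: "Z > 0" unfolding Z_def by (intro sum_pos cube_nonempty) auto
    have px: "p x = 2 ^ k * exp (\<phi> x) / Z" if "x \<in> cube k" for x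
      using that by (simp add: p exp_density_def Z_def cube_weight_def sum_divide_distrib[symmetric])
    have "(\<Sum>x\<in>cube k. p x) = 2 ^ k * Z / Z"
      by (simp add: px Z_def sum_divide_distrib[symmetric] sum_distrib_left[symmetric])
    then show "p \<in> ?R" using Z px by (auto simp: p exp_density_def)
  qed
  show "?R \<subseteq> ?L"
  proof
    fix p assume p: "p \<in> ?R"
    define \<phi> where "\<phi> = (\<lambda>x\<in>cube k. ln (p x))"
    have e: "exp (\<phi> x) = p x" if "x \<in> cube k" for x
      using that p by (simp add: \<phi>_def)
    have "(\<Sum>y\<in>cube k. exp (\<phi> y) * cube_weight k y) = 1"
      using p by (simp add: e cube_weight_def sum_divide_distrib[symmetric])
    then have "exp_density k \<phi> = p"
      using p e by (auto simp: exp_density_def fun_eq_iff extensional_def restrict_def)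
    moreover have "\<phi> \<in> walsh_space k" by (simp add: walsh_space_eq_extensional \<phi>_def)
    ultimately show "p \<in> ?L" unfolding exp_family_def by blast
  qed
qed

text \<open>
  The supremum in the definition of the MLE is a supremum of reals, which bounds its members
  only if it is taken over a bounded set.
\<close>

lemma bdd_above_likelihood:
  assumes "\<And>i. i \<in> {1..n} \<Longrightarrow> x i \<in> cube k"
  shows "bdd_above (likelihood n x ` exp_family k (walsh_space k))"
proof (rule bdd_aboveI2)
  fix q assume q: "q \<in> exp_family k (walsh_space k)"
  have "q (x i) \<le> 2 ^ k" "0 \<le> q (x i)" if "i \<in> {1..n}" for i
  proof -
    have "q (x i) \<le> (\<Sum>x\<in>cube k. q x)"
      using q assms[OF that] by (intro member_le_sum) (auto simp: exp_family_walsh_space less_imp_le)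
    then show "q (x i) \<le> 2 ^ k" using q by (simp add: exp_family_walsh_space)
    show "0 \<le> q (x i)" using q assms[OF that] by (simp add: exp_family_walsh_space less_imp_le)
  qed
  then show "likelihood n x q \<le> (\<Prod>i\<in>{1..n}. 2 ^ k)"
    unfolding likelihood_def by (intro prod_mono) auto
qed

text \<open>
  The maximizer is the empirical density \<open>p\<close>, which lies in the family because each point was
  sampled at least once. That it beats every other density \<open>q\<close> is Gibbs' inequality: from
  \<open>u \<le> exp (u - 1)\<close> the likelihood ratio is at most \<open>exp (\<Sum>i. q (x i) / p (x i) - 1)\<close>, and
  grouping this sum by the sampled points gives \<open>n / 2\<^sup>k * (\<Sum>y. q y) - n = 0\<close>.
\<close>

lemma MLE_if_covering:
  assumes cov: "x ` {1..n} = cube k"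
  shows "\<exists>p. is_MLE k (walsh_space k) n x p"
proof -
  have n: "n > 0" using cov cube_nonempty[of k] by (cases n) auto
  define m where "m y = card {i\<in>{1..n}. x i = y}" for y
  define p where "p = (\<lambda>y\<in>cube k. 2 ^ k * real (m y) / n)"
  have regroup: "(\<Sum>i=1..n. f (x i)) = (\<Sum>y\<in>cube k. real (m y) * f y)" for f :: "_ \<Rightarrow> real"
  proof -
    have "(\<Sum>i=1..n. f (x i)) = (\<Sum>y\<in>cube k. \<Sum>i\<in>{i\<in>{1..n}. x i = y}. f (x i))"
      using cov by (intro sum.group[symmetric]) auto
    also have "\<dots> = (\<Sum>y\<in>cube k. real (m y) * f y)"
      by (intro sum.cong) (auto simp: m_def)
    finally show ?thesis .
  qed
  have m_pos: "m y > 0" if "y \<in> cube k" for y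
    using that unfolding cov[symmetric] m_def by (auto simp: card_gt_0_iff)
  have p_pos: "p y > 0" if "y \<in> cube k" for y using m_pos[OF that] n that by (simp add: p_def)
  have "(\<Sum>y\<in>cube k. real (m y)) = n" using regroup[of "\<lambda>_. 1"] by simp
  then have "(\<Sum>y\<in>cube k. p y) = 2 ^ k"
    using n by (simp add: p_def sum_divide_distrib[symmetric] sum_distrib_left[symmetric])
  then have p: "p \<in> exp_family k (walsh_space k)"
    using p_pos by (auto simp: exp_family_walsh_space p_def)
  have "likelihood n x q \<le> likelihood n x p" if q: "q \<in> exp_family k (walsh_space k)" for q
  proof -
    have x: "x i \<in> cube k" if "i \<in> {1..n}" for i using that cov by auto
    have q_pos: "q y > 0" if "y \<in> cube k" for y using q that by (simp add: exp_family_walsh_space)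
    have "real (m y) * (q y / p y - 1) = n / 2 ^ k * q y - m y" if "y \<in> cube k" for y
      using m_pos[OF that] that n by (simp add: p_def field_simps)
    then have "(\<Sum>i=1..n. q (x i) / p (x i) - 1) = (\<Sum>y\<in>cube k. n / 2 ^ k * q y - m y)"
      by (subst regroup) (auto intro: sum.cong)
    also have "\<dots> = 0"
      using q \<open>(\<Sum>y\<in>cube k. real (m y)) = n\<close>
      by (simp only: sum_subtractf sum_distrib_left[symmetric] exp_family_walsh_space) simp
    finally have s0: "(\<Sum>i=1..n. q (x i) / p (x i) - 1) = 0" .
    have "(\<Prod>i=1..n. q (x i) / p (x i)) \<le> (\<Prod>i=1..n. exp (q (x i) / p (x i) - 1))"
    proof (intro prod_mono conjI)
      fix i assume "i \<in> {1..n}"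
      then show "0 \<le> q (x i) / p (x i)" using q_pos[OF x] p_pos[OF x] by (simp add: less_imp_le)
      show "q (x i) / p (x i) \<le> exp (q (x i) / p (x i) - 1)"
        using exp_ge_add_one_self[of "q (x i) / p (x i) - 1"] by simp
    qed
    also have "\<dots> = 1" using s0 by (simp only: exp_sum[symmetric] finite_atLeastAtMost exp_zero)
    finally have "(\<Prod>i=1..n. q (x i)) / (\<Prod>i=1..n. p (x i)) \<le> 1" by (simp only: prod_dividef)
    moreover have "(\<Prod>i=1..n. p (x i)) > 0" using p_pos[OF x] by (intro prod_pos) auto
    ultimately show ?thesis by (simp add: likelihood_def)
  qed
  then have "likelihood n x p = (SUP q\<in>exp_family k (walsh_space k). likelihood n x q)"
    using p by (intro cSup_eq_maximum[symmetric]) auto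
  then show ?thesis using p unfolding is_MLE_def by blast
qed

text \<open>
  If \<open>y\<close> was not sampled, halve \<open>p y\<close> and normalize again. The normalization multiplies the
  density at all sampled points by the same factor \<open>2\<^sup>k / s > 1\<close>, so \<open>p\<close> was no maximizer.
\<close>

lemma covering_if_MLE:
  assumes n: "n \<ge> 1" and x: "\<And>i. i \<in> {1..n} \<Longrightarrow> x i \<in> cube k"
    and MLE: "is_MLE k (walsh_space k) n x p"
  shows "x ` {1..n} = cube k"
proof (rule ccontr)
  assume "x ` {1..n} \<noteq> cube k"
  then obtain y where y: "y \<in> cube k" "y \<notin> x ` {1..n}" using x by blast
  have p: "p \<in> exp_family k (walsh_space k)"
    and sup: "likelihood n x p = (SUP q\<in>exp_family k (walsh_space k). likelihood n x q)"
    using MLE by (auto simp: is_MLE_def)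
  have p_pos: "p z > 0" if "z \<in> cube k" for z using p that by (simp add: exp_family_walsh_space)
  define r where "r = p(y := p y / 2)"
  define s where "s = (\<Sum>z\<in>cube k. r z)"
  have r_pos: "r z > 0" if "z \<in> cube k" for z using p_pos[OF that] by (auto simp: r_def)
  have s_pos: "s > 0" unfolding s_def using r_pos cube_nonempty by (intro sum_pos) auto
  have "s < (\<Sum>z\<in>cube k. p z)"
    unfolding s_def using y(1) p_pos by (intro sum_strict_mono_ex1) (auto simp: r_def less_imp_le intro!: bexI[of _ y])
  then have s_less: "s < 2 ^ k" using p by (simp add: exp_family_walsh_space)
  define q where "q = (\<lambda>z\<in>cube k. 2 ^ k / s * r z)"
  have "(\<Sum>z\<in>cube k. q z) = 2 ^ k / s * s"
    unfolding q_def s_def sum_distrib_left by (intro sum.cong) auto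
  then have q: "q \<in> exp_family k (walsh_space k)"
    using r_pos s_pos by (auto simp: exp_family_walsh_space q_def)
  have "likelihood n x q = (\<Prod>i=1..n. 2 ^ k / s * p (x i))"
    unfolding likelihood_def using x y by (intro prod.cong) (auto simp: q_def r_def)
  also have "\<dots> = (2 ^ k / s) ^ n * likelihood n x p"
    by (simp only: likelihood_def prod.distrib prod_constant card_atLeastAtMost diff_Suc_1 Suc_eq_plus1[symmetric])
  also have "\<dots> > likelihood n x p"
  proof -
    have "likelihood n x p > 0" unfolding likelihood_def using p_pos x by (intro prod_pos) auto
    moreover have "(2 ^ k / s) ^ n > 1" using n s_pos s_less by (intro one_less_power) auto
    ultimately show ?thesis by simp
  qed
  also have "likelihood n x q \<le> likelihood n x p"
    unfolding sup using bdd_above_likelihood[OF x] q by (intro cSUP_upper) auto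
  finally show False by simp
qed

text \<open>
  A sample that covers the cube continues to do so when it is enlarged, so it suffices to look
  at the largest integer below \<open>t\<close>.
\<close>

lemma MLE_time_less_iff:
  assumes x: "\<And>i. i \<ge> 1 \<Longrightarrow> x i \<in> cube k" and t: "0 < t"
  shows "ereal_of_enat (MLE_time k (walsh_space k) x) < ereal t
    \<longleftrightarrow> x ` {1..nat (\<lceil>t\<rceil> - 1)} = cube k" (is "?L \<longleftrightarrow> _ ` {1..?n} = _")
proof
  assume ?L
  then obtain m where m: "MLE_time k (walsh_space k) x = enat m" "real m < t"
    by (cases "MLE_time k (walsh_space k) x") auto
  then have "MLE_time k (walsh_space k) x < enat (Suc m)" by simp
  then obtain n p where n: "n < Suc m" "n \<ge> 1" "is_MLE k (walsh_space k) n x p"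
    unfolding MLE_time_def INF_less_iff by auto
  have "real n < t" using n(1) m(2) by linarith
  then have "n \<le> ?n" by linarith
  moreover have "x ` {1..n} = cube k" using n x by (intro covering_if_MLE) auto
  ultimately show "x ` {1..?n} = cube k" using x by fastforce
next
  assume cov: "x ` {1..?n} = cube k"
  then have "?n \<ge> 1" using cube_nonempty[of k] by (cases ?n) auto
  then have "MLE_time k (walsh_space k) x \<le> enat ?n"
    unfolding MLE_time_def using MLE_if_covering[OF cov] by (intro INF_lower) auto
  then have "ereal_of_enat (MLE_time k (walsh_space k) x) \<le> ereal (real ?n)"
    by (metis ereal_of_enat_le_iff ereal_of_enat_simps(1))
  also have "\<dots> < ereal t" using t by simp linarith
  finally show ?L .
qed

section \<open>The coupon collector\<close>

locale coupon_collector = prob_space M for M :: "'a measure" +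
  fixes C :: "'b set" and X :: "nat \<Rightarrow> 'a \<Rightarrow> 'b"
  assumes finite_C: "finite C"
    and card_C: "card C \<ge> 2"
    and indep_X: "indep_vars (\<lambda>_. count_space C) X {1..}"
    and unif_X: "\<And>i. i \<ge> 1 \<Longrightarrow> distr M (count_space C) (X i) = uniform_count_measure C"
begin

definition avoid :: "nat \<Rightarrow> 'b set \<Rightarrow> 'a set" where
  "avoid n A = {\<omega> \<in> space M. \<forall>i\<in>{1..n}. X i \<omega> \<notin> A}"


lemma measurable_X: "i \<ge> 1 \<Longrightarrow> X i \<in> measurable M (count_space C)"
  using indep_X unfolding indep_vars_def by auto

lemma in_C: "i \<ge> 1 \<Longrightarrow> \<omega> \<in> space M \<Longrightarrow> X i \<omega> \<in> C"
  using measurable_space[OF measurable_X] by simp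

lemma avoid_eq_INT:
  assumes "n \<ge> 1"
  shows "avoid n A = (\<Inter>i\<in>{1..n}. X i -` (C - A) \<inter> space M)"
  using assms in_C by (fastforce simp: avoid_def)

lemma avoid_measurable: "avoid n A \<in> events"
proof (cases "n = 0")
  case True
  then show ?thesis by (simp add: avoid_def)
next
  case False
  then show ?thesis
    by (subst avoid_eq_INT, simp, intro sets.finite_INT measurable_sets[OF measurable_X]) auto
qed

lemma prob_avoid:
  assumes A: "A \<subseteq> C"
  shows "prob (avoid n A) = (1 - card A / card C) ^ n"
proof (cases "n = 0")
  case True
  then show ?thesis by (simp add: avoid_def prob_space)
next
  case False
  have "prob (X i -` (C - A) \<inter> space M) = 1 - card A / card C" if i: "i \<in> {1..n}" for i
  proof -
    have "prob (X i -` (C - A) \<inter> space M) = measure (distr M (count_space C) (X i)) (C - A)"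
      using i by (intro measure_distr[symmetric] measurable_X) auto
    also have "\<dots> = card (C - A) / card C"
      using i by (simp add: unif_X measure_uniform_count_measure[OF finite_C])
    also have "\<dots> = 1 - card A / card C"
      using A card_C finite_C card_gt_0_iff[of C]
      by (simp add: card_Diff_subset finite_subset of_nat_diff card_mono diff_divide_distrib)
    finally show ?thesis .
  qed
  moreover have "prob (avoid n A) = (\<Prod>i\<in>{1..n}. prob (X i -` (C - A) \<inter> space M))"
    using False by (subst avoid_eq_INT, simp, intro indep_varsD[OF indep_X]) auto
  ultimately show ?thesis by simp
qed

definition covered :: "nat \<Rightarrow> 'a set" where
  "covered n = {\<omega> \<in> space M. (\<lambda>i. X i \<omega>) ` {1..n} = C}"

lemma covered_eq: "covered n = space M - (\<Union>c\<in>C. avoid n {c})"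
  using in_C by (fastforce simp: covered_def avoid_def)

lemma covered_measurable: "covered n \<in> events"
  unfolding covered_eq using finite_C avoid_measurable by auto

text \<open>The union bound over the coupon that is missing.\<close>

lemma prob_covered_ge:
  "prob (covered n) \<ge> 1 - card C * (1 - 1 / card C) ^ n"
proof -
  have "prob (\<Union>c\<in>C. avoid n {c}) \<le> (\<Sum>c\<in>C. prob (avoid n {c}))"
    using finite_C avoid_measurable by (intro finite_measure_subadditive_finite) auto
  also have "\<dots> = card C * (1 - 1 / card C) ^ n"
    by (simp add: prob_avoid)
  finally show ?thesis
    unfolding covered_eq using finite_C avoid_measurable by (subst prob_compl) auto
qed

text \<open>
  The second moment method, applied to the number \<open>W\<close> of missing coupons: its variance is at most
  its mean \<open>N q\<close>, and a complete collection means that \<open>W = 0\<close> deviates from the mean by \<open>N q\<close>.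
\<close>

lemma prob_covered_le:
  "prob (covered n) \<le> 1 / (card C * (1 - 1 / card C) ^ n)"
proof -
  define N where "N = real (card C)"
  define q where "q = (1 - 1 / N) ^ n"
  define W where "W \<omega> = (\<Sum>c\<in>C. indicat_real (avoid n {c}) \<omega>)" for \<omega>
  have N: "N \<ge> 2" using card_C by (simp add: N_def)
  then have q: "q > 0" by (simp add: q_def)
  have int: "integrable M (indicat_real (avoid n A))" for A
    using avoid_measurable by (intro integrable_real_indicator) (auto simp: emeasure_eq_measure)
  have W_int: "integrable M W" unfolding W_def by (intro Bochner_Integration.integrable_sum int)
  have "expectation W = (\<Sum>c\<in>C. prob (avoid n {c}))"
    unfolding W_def using int avoid_measurable by (subst Bochner_Integration.integral_sum) auto
  also have "\<dots> = N * q" by (simp add: prob_avoid N_def q_def)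
  finally have EW: "expectation W = N * q" .
  have W2: "(W \<omega>)\<^sup>2 = (\<Sum>c\<in>C. \<Sum>d\<in>C. indicat_real (avoid n {c, d}) \<omega>)" for \<omega>
    unfolding W_def power2_eq_square sum_product
    by (intro sum.cong refl) (auto simp: avoid_def indicator_def)
  have W2_int: "integrable M (\<lambda>\<omega>. (W \<omega>)\<^sup>2)"
    unfolding W2 by (intro Bochner_Integration.integrable_sum int)
  have "expectation (\<lambda>\<omega>. (W \<omega>)\<^sup>2) = (\<Sum>c\<in>C. \<Sum>d\<in>C. prob (avoid n {c, d}))"
    unfolding W2 using int avoid_measurable
    by (simp add: Bochner_Integration.integral_sum)
  also have "\<dots> \<le> (\<Sum>c\<in>C. \<Sum>d\<in>C. (if c = d then q else 0) + q\<^sup>2)"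
  proof (intro sum_mono)
    fix c d assume cd: "c \<in> C" "d \<in> C"
    show "prob (avoid n {c, d}) \<le> (if c = d then q else 0) + q\<^sup>2"
    proof (cases "c = d")
      case True
      then show ?thesis using cd by (simp add: prob_avoid N_def q_def)
    next
      case False
      \<comment> \<open>No positive correlation between the events that \<open>c\<close> and that \<open>d\<close> is missing.\<close>
      have "(1 - 1 / N)\<^sup>2 - (1 - 2 / N) = (1 / N)\<^sup>2" by (simp add: power2_eq_square algebra_simps)
      then have "1 - 2 / N \<le> (1 - 1 / N)\<^sup>2" by (metis diff_ge_0_iff_ge zero_le_power2)
      then have "(1 - 2 / N) ^ n \<le> ((1 - 1 / N)\<^sup>2) ^ n" using N by (intro power_mono) auto
      then show ?thesis using False cd
        by (simp add: prob_avoid N_def q_def power_mult[symmetric] mult.commute)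
    qed
  qed
  also have "\<dots> = N * q + (N * q)\<^sup>2"
    using finite_C by (simp add: sum.distrib N_def power2_eq_square algebra_simps)
  finally have "variance W \<le> N * q"
    using W_int W2_int by (subst variance_eq) (auto simp: EW)
  have "covered n \<subseteq> {\<omega> \<in> space M. N * q \<le> \<bar>W \<omega> - expectation W\<bar>}"
    using N q by (auto simp: covered_eq W_def EW)
  then have "prob (covered n) \<le> prob {\<omega> \<in> space M. N * q \<le> \<bar>W \<omega> - expectation W\<bar>}"
    using W_int by (intro finite_measure_mono) auto
  also have "\<dots> \<le> variance W / (N * q)\<^sup>2"
    using W_int W2_int N q by (intro Chebyshev_inequality) auto
  also have "\<dots> \<le> (N * q) / (N * q)\<^sup>2"
    using \<open>variance W \<le> N * q\<close> by (intro divide_right_mono) auto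
  also have "\<dots> = 1 / (N * q)" by (simp add: power2_eq_square)
  finally show ?thesis by (simp add: N_def q_def)
qed

text \<open>
  The expected number of missing coupons is bounded below through
  \<open>1 / (1 - 1/N) = 1 + 1 / (N - 1) \<le> exp (1 / (N - 1))\<close>; hence the denominator \<open>N - 1\<close>.
\<close>

lemma prob_covered_le_exp:
  "prob (covered n) \<le> exp (real n / (card C - 1) - ln (card C))"
proof -
  define N where "N = real (card C)"
  have N: "N \<ge> 2" using card_C by (simp add: N_def)
  have "1 / (1 - 1 / N) = 1 + 1 / (N - 1)" using N by (simp add: field_simps)
  also have "\<dots> \<le> exp (1 / (N - 1))" by (rule exp_ge_add_one_self)
  finally have "(1 / (1 - 1 / N)) ^ n \<le> exp (1 / (N - 1)) ^ n"
    using N by (intro power_mono) auto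
  then have "1 / (1 - 1 / N) ^ n \<le> exp (n / (N - 1))"
    by (simp add: exp_of_nat_mult[symmetric] power_one_over)
  then have "1 / (N * (1 - 1 / N) ^ n) \<le> exp (n / (N - 1)) / N"
    using N by (simp add: divide_simps split: if_splits)
  also have "\<dots> = exp (n / (N - 1) - ln N)" using N by (simp add: exp_diff)
  finally show ?thesis using prob_covered_le[of n] card_C by (simp add: N_def of_nat_diff)
qed

lemma prob_covered_ge_exp:
  "prob (covered n) \<ge> 1 - exp (ln (card C) - real n / card C)"
proof -
  define N where "N = real (card C)"
  have N: "N \<ge> 2" using card_C by (simp add: N_def)
  have "(1 - 1 / N) ^ n \<le> exp (- (1 / N)) ^ n"
    using N exp_ge_add_one_self[of "- (1 / N)"] by (intro power_mono) auto
  also have "\<dots> = exp (- (n / N))" by (simp add: exp_of_nat_mult[symmetric])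
  finally have "N * (1 - 1 / N) ^ n \<le> N * exp (- (n / N))" using N by simp
  also have "\<dots> = exp (ln N - n / N)" using N by (simp add: exp_diff exp_minus divide_inverse)
  finally show ?thesis using prob_covered_ge[of n] by (simp add: N_def)
qed

end

section \<open>The threshold\<close>

theorem corollary5p4:
  fixes M :: "nat \<Rightarrow> 'a measure"
    and X :: "nat \<Rightarrow> nat \<Rightarrow> 'a \<Rightarrow> nat \<Rightarrow> real"
    and \<nu> :: "nat \<Rightarrow> 'a \<Rightarrow> enat"
    and \<epsilon> :: real
  assumes eps: "0 < \<epsilon>" "\<epsilon> < 1"
    and prob: "\<And>k. k \<ge> 1 \<Longrightarrow> prob_space (M k)"
    and indep: "\<And>k. k \<ge> 1 \<Longrightarrow>
      prob_space.indep_vars (M k) (\<lambda>_. count_space (cube k)) (X k) {1..}"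
    and unif: "\<And>k i. k \<ge> 1 \<Longrightarrow> i \<ge> 1 \<Longrightarrow>
      distr (M k) (count_space (cube k)) (X k i) = uniform_count_measure (cube k)"
    and nu: "\<And>k \<omega>. k \<ge> 1 \<Longrightarrow> \<omega> \<in> space (M k) \<Longrightarrow>
      \<nu> k \<omega> = MLE_time k (walsh_space k) (\<lambda>i. X k i \<omega>)"
  shows "(\<lambda>k. measure (M k) {\<omega> \<in> space (M k).
            ereal_of_enat (\<nu> k \<omega>) < ereal ((1 - \<epsilon>) * (real k * 2 ^ k * ln 2))})
          \<longlonglongrightarrow> 0
       \<and> (\<lambda>k. measure (M k) {\<omega> \<in> space (M k).
            ereal_of_enat (\<nu> k \<omega>) < ereal ((1 + \<epsilon>) * (real k * 2 ^ k * ln 2))})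
          \<longlonglongrightarrow> 1"
proof -
  have coupon: "coupon_collector (M k) (cube k) (X k)" if "k \<ge> 1" for k
  proof -
    have "(2::nat) ^ 1 \<le> 2 ^ k" using that by (intro power_increasing) auto
    then show ?thesis
      using that prob indep unif
      by (auto simp: coupon_collector_def coupon_collector_axioms_def)
  qed
  have event: "{\<omega> \<in> space (M k). ereal_of_enat (\<nu> k \<omega>) < ereal t}
      = coupon_collector.covered (M k) (cube k) (X k) (nat (\<lceil>t\<rceil> - 1))"
    if k: "k \<ge> 1" and t: "0 < t" for k t
  proof -
    interpret coupon_collector "M k" "cube k" "X k" using coupon[OF k] .
    show ?thesis
      unfolding covered_def using nu[OF k] MLE_time_less_iff[OF in_C t] by (intro Collect_cong conj_cong) auto
  qed
  have ev: "\<forall>\<^sub>F k in sequentially. k \<ge> (1::nat)" by (rule eventually_ge_at_top)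
  have "(\<lambda>k. measure (M k) {\<omega> \<in> space (M k).
      ereal_of_enat (\<nu> k \<omega>) < ereal ((1 - \<epsilon>) * (real k * 2 ^ k * ln 2))}) \<longlonglongrightarrow> 0"
  proof (rule tendsto_sandwich)
    show "\<forall>\<^sub>F k in sequentially. 0 \<le> measure (M k) {\<omega> \<in> space (M k).
        ereal_of_enat (\<nu> k \<omega>) < ereal ((1 - \<epsilon>) * (real k * 2 ^ k * ln 2))}" by simp
    show "\<forall>\<^sub>F k in sequentially. measure (M k) {\<omega> \<in> space (M k).
        ereal_of_enat (\<nu> k \<omega>) < ereal ((1 - \<epsilon>) * (real k * 2 ^ k * ln 2))}
      \<le> exp (1 - \<epsilon> * (real k * ln 2))"
      using ev
    proof eventually_elim
      case (elim k)
      interpret coupon_collector "M k" "cube k" "X k" using coupon[OF elim] .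
      define t where "t = (1 - \<epsilon>) * (real k * 2 ^ k * ln 2)"
      have t: "t > 0" using elim eps by (simp add: t_def)
      have two_k: "(2::real) ^ k > 1" using elim by (intro one_less_power) auto
      have "(1 - \<epsilon>) * (k * ln 2) \<le> k * ln 2"
        using eps by (intro mult_left_le_one_le) auto
      also have "\<dots> \<le> 2 ^ k - 1" using ln_le_minus_one[of "2 ^ k"] by (simp add: ln_realpow)
      finally have "(1 - \<epsilon>) * (k * ln 2) / (2 ^ k - 1) \<le> 1" using two_k by simp
      \<comment> \<open>The coefficient \<open>N / (N - 1)\<close> is \<open>1 + 1 / (N - 1)\<close>, and the contribution of
        \<open>1 / (N - 1)\<close> to the exponent is bounded since \<open>ln N \<le> N - 1\<close>.\<close>
      moreover have "t / (2 ^ k - 1) = (1 - \<epsilon>) * (k * ln 2) + (1 - \<epsilon>) * (k * ln 2) / (2 ^ k - 1)"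
        using two_k by (simp add: t_def field_simps)
      moreover have "real (nat (\<lceil>t\<rceil> - 1)) \<le> t" using t by linarith
      then have "real (nat (\<lceil>t\<rceil> - 1)) / (2 ^ k - 1) \<le> t / (2 ^ k - 1)"
        using two_k by (intro divide_right_mono) auto
      ultimately have "real (nat (\<lceil>t\<rceil> - 1)) / (2 ^ k - 1) \<le> (1 - \<epsilon>) * (k * ln 2) + 1"
        by linarith
      then have "exp (real (nat (\<lceil>t\<rceil> - 1)) / (2 ^ k - 1) - ln (2 ^ k)) \<le> exp (1 - \<epsilon> * (k * ln 2))"
        by (simp add: ln_realpow algebra_simps)
      then show ?case
        using order_trans[OF prob_covered_le_exp[of "nat (\<lceil>t\<rceil> - 1)"]]
        unfolding event[OF elim t] t_def[symmetric] by (simp add: of_nat_diff del: exp_le_cancel_iff)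
    qed
    show "(\<lambda>k. exp (1 - \<epsilon> * (real k * ln 2))) \<longlonglongrightarrow> 0"
      using eps by real_asymp
  qed simp
  moreover have "(\<lambda>k. measure (M k) {\<omega> \<in> space (M k).
      ereal_of_enat (\<nu> k \<omega>) < ereal ((1 + \<epsilon>) * (real k * 2 ^ k * ln 2))}) \<longlonglongrightarrow> 1"
  proof (rule tendsto_sandwich)
    show "\<forall>\<^sub>F k in sequentially. measure (M k) {\<omega> \<in> space (M k).
        ereal_of_enat (\<nu> k \<omega>) < ereal ((1 + \<epsilon>) * (real k * 2 ^ k * ln 2))} \<le> 1"
      using ev by eventually_elim (simp add: prob prob_space.prob_le_1)
    show "\<forall>\<^sub>F k in sequentially. 1 - exp (1 - \<epsilon> * (real k * ln 2)) \<le> measure (M k) {\<omega> \<in> space (M k).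
        ereal_of_enat (\<nu> k \<omega>) < ereal ((1 + \<epsilon>) * (real k * 2 ^ k * ln 2))}"
      using ev
    proof eventually_elim
      case (elim k)
      interpret coupon_collector "M k" "cube k" "X k" using coupon[OF elim] .
      define t where "t = (1 + \<epsilon>) * (real k * 2 ^ k * ln 2)"
      have t: "t > 0" using elim eps by (simp add: t_def)
      \<comment> \<open>The largest integer below \<open>t\<close> is at least \<open>t - 1\<close>. Giving up \<open>2 ^ k\<close> instead of \<open>1\<close>
        costs only the constant \<open>1\<close> in the exponent.\<close>
      have "t - 2 ^ k \<le> t - 1" by simp
      also have "\<dots> \<le> real (nat (\<lceil>t\<rceil> - 1))" using t by linarith
      finally have "(t - 2 ^ k) / 2 ^ k \<le> real (nat (\<lceil>t\<rceil> - 1)) / 2 ^ k"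
        by (intro divide_right_mono) auto
      moreover have "(t - 2 ^ k) / 2 ^ k = (1 + \<epsilon>) * (real k * ln 2) - 1"
        by (simp add: t_def field_simps)
      ultimately have "exp (ln (2 ^ k) - real (nat (\<lceil>t\<rceil> - 1)) / 2 ^ k) \<le> exp (1 - \<epsilon> * (k * ln 2))"
        by (simp add: ln_realpow algebra_simps)
      then show ?case
        using prob_covered_ge_exp[of "nat (\<lceil>t\<rceil> - 1)"]
        unfolding event[OF elim t] t_def[symmetric] by (simp del: exp_le_cancel_iff)
    qed
    show "(\<lambda>k. 1 - exp (1 - \<epsilon> * (real k * ln 2))) \<longlonglongrightarrow> 1"
      using eps by real_asymp
  qed simp
  ultimately show ?thesis ..
qed

end
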